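(* For every $n\in\mathbb{N}$, both $12^{-n}\det[D_{i+j}]_{0\le i,j\le n}$ and $2^{-n(n+3)}\det[P_{i+j}]_{0\le i,j\le n}$ are positive odd integers.
   Context: For $m\in\mathbb{N}$, the Domb numbers are $D_m=\sum_{k=0}^m\binom{m}{k}^2\binom{2k}{k}\binom{2(m-k)}{m-k}$, and the Catalan–Larcombe–French numbers are $P_m=\sum_{k=0}^m\frac{\binom{2k}{k}^2\binom{2(m-k)}{m-k}^2}{\binom{m}{k}}$. For a sequence $(a_m)_{m\ge0}$, $\det[a_{i+j}]_{0\le i,j\le n}$ denotes the determinant of the $(n+1)\times(n+1)$ Hankel matrix with $(i,j)$-entry $a_{i+j}$. *)

theory Defs
  imports Complex_Main "Jordan_Normal_Form.Determinant"
begin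

definition domb :: "nat \<Rightarrow> int" where
  "domb m = (\<Sum>k=0..m. int ((m choose k)^2 * ((2*k) choose k) * ((2*(m-k)) choose (m-k))))"

text \<open>Catalan--Larcombe--French numbers (defined over the rationals, since the
  defining sum contains a division).\<close>
definition clf :: "nat \<Rightarrow> rat" where
  "clf m = (\<Sum>k=0..m. of_nat ((((2*k) choose k)^2) * (((2*(m-k)) choose (m-k))^2))
                        / of_nat (m choose k))"

definition hankel :: "(nat \<Rightarrow> 'a) \<Rightarrow> nat \<Rightarrow> 'a mat" where
  "hankel a n = mat (Suc n) (Suc n) (\<lambda>(i,j). a (i+j))"

end

theory Submission
  imports Defs "HOL-Number_Theory.Cong" "HOL-Computational_Algebra.Formal_Power_Series"
begin

text \<open>For \<open>a\<^sub>0 = 1\<close>, clearing the first row by column operations turns \<open>det[a\<^sub>i\<^sub>+\<^sub>j]\<close> into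
  \<open>det[a\<^sub>i\<^sub>+\<^sub>j - a\<^sub>i a\<^sub>j]\<close> with \<open>i, j \<ge> 1\<close>. If \<open>a\<^sub>m \<equiv> 2 C(2m,m)\<close> modulo 8, the new entries are, modulo 8,
  four times \<open>C(2(i+j), i+j)/2\<close>, and Vandermonde's identity factors the latter modulo 2 as
  \<open>N N\<^sup>T\<close> with \<open>N = [C(2i, i+s)]\<close> lower unitriangular; so the determinant is \<open>4\<^sup>n\<close> times an odd
  number. Pairing \<open>k\<close> with \<open>m - k\<close> shows that the Domb numbers satisfy this congruence; they are
  also \<open>1\<close> modulo 3, because they are sums of squares of quadrinomial coefficients, on which a
  3-cycle of the indices acts. This gives the factor \<open>12\<^sup>n\<close>.

  The Catalan--Larcombe--French numbers are \<open>2\<^sup>m\<close> times the binomial transform (with parameter 4)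
  of \<open>c\<^sub>m\<^sup>2\<close>, where \<open>c\<^sub>m = C(m, m/2)\<close> for even \<open>m\<close> and \<open>0\<close> otherwise, because both sides satisfy
  \<open>(n+1)\<^sup>2 P\<^sub>n\<^sub>+\<^sub>1 = 8(3n\<^sup>2+3n+1) P\<^sub>n - 128 n\<^sup>2 P\<^sub>n\<^sub>-\<^sub>1\<close>. Hence their Hankel determinant is
  \<open>2\<^bsup>n(n+1)\<^esup>\<close> times that of \<open>c\<^sub>m\<^sup>2\<close>, which again satisfies the congruence modulo 8.

  Both \<open>D\<^sub>m\<close> and \<open>c\<^sub>m\<^sup>2\<close> are moments of positive measures, so their Hankel forms are nonnegative;
  as the determinants are nonzero by parity, they are positive.\<close>

section \<open>Hankel determinants modulo powers of two\<close>

lemma det_cong: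
  fixes A B :: "int mat"
  assumes A: "A \<in> carrier_mat n n" and B: "B \<in> carrier_mat n n"
    and AB: "\<And>i j. i < n \<Longrightarrow> j < n \<Longrightarrow> [A $$ (i,j) = B $$ (i,j)] (mod q)"
  shows "[det A = det B] (mod q)"
  unfolding det_def'[OF A] det_def'[OF B]
  by (intro cong_sum cong_mult cong_refl cong_prod AB) (auto simp: permutes_in_image)

lemma det_hankel_split:
  fixes a :: "nat \<Rightarrow> 'a :: comm_ring_1"
  assumes a0: "a 0 = 1"
  shows "det (hankel a n) = det (mat n n (\<lambda>(i,j). a (Suc i + Suc j) - a (Suc i) * a (Suc j)))"
    (is "_ = det ?E")
proof -
  define H where "H = hankel a n"
  have H: "H \<in> carrier_mat (Suc n) (Suc n)" by (simp add: H_def hankel_def)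
  define U where "U = mat (Suc n) (Suc n) (\<lambda>(k,j). (if k = j then 1 else 0)
     - (if k = 0 then if j = 0 then 0 else a j else 0))"
  have U: "U \<in> carrier_mat (Suc n) (Suc n)" by (simp add: U_def)
  have ut: "upper_triangular U" by (auto simp: U_def upper_triangular_def)
  have detU: "det U = 1"
    unfolding det_upper_triangular[OF ut U] prod_list_diag_prod
    by (rule prod.neutral) (auto simp: U_def)
  define K where "K = mat (Suc n) (Suc n) (\<lambda>(i,j). a (i+j) - (if j = 0 then 0 else a i * a j))"
  have K: "K \<in> carrier_mat (Suc n) (Suc n)" by (simp add: K_def)
  \<comment> \<open>Multiplying by \<open>U\<close> on the right subtracts \<open>a j\<close> times
    column 0 from each column j > 0. As \<open>a 0 = 1\<close>, the first row of \<open>K\<close> is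
    (1, 0, ..., 0).\<close>
  have "H * U = K"
  proof (rule eq_matI)
    fix i j assume "i < dim_row K" "j < dim_col K"
    then have ij: "i < Suc n" "j < Suc n" by (auto simp: K_def)
    have "(H * U) $$ (i,j) = (\<Sum>k\<in>{0..<Suc n}. a (i+k) * U $$ (k,j))"
      using ij H U by (simp add: scalar_prod_def H_def hankel_def)
    also have "\<dots> = (\<Sum>k\<in>{0..<Suc n}. (if k = j then a (i+k) else 0)
        - (if k = 0 then (if j = 0 then 0 else a (i+k) * a j) else 0))"
      by (rule sum.cong) (use ij in \<open>auto simp: U_def algebra_simps\<close>)
    also have "\<dots> = a (i+j) - (if j = 0 then 0 else a i * a j)"
      unfolding sum_subtractf using ij by (subst (1 2) sum.delta) auto
    finally show "(H * U) $$ (i,j) = K $$ (i,j)" using ij by (simp add: K_def)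
  qed (use H U K in auto)
  then have "det H = det K"
    using det_mult[OF H U] detU by simp
  also have "det K = (\<Sum>j<Suc n. K $$ (0,j) * cofactor K 0 j)"
    by (rule laplace_expansion_row[OF K]) simp
  also have "\<dots> = (\<Sum>j<Suc n. if j = 0 then cofactor K 0 j else 0)"
    by (rule sum.cong) (auto simp: K_def a0)
  also have "\<dots> = cofactor K 0 0" by (subst sum.delta) auto
  also have "\<dots> = det (mat_delete K 0 0)" by (simp add: cofactor_def)
  also have "mat_delete K 0 0 = ?E"
    by (rule eq_matI) (auto simp: mat_delete_def K_def insert_index_def)
  finally show ?thesis by (simp add: H_def)
qed

lemma det_mat_smult:
  fixes f :: "nat \<Rightarrow> nat \<Rightarrow> 'a :: comm_ring_1"
  shows "det (mat n n (\<lambda>(i,j). c * f i j)) = c ^ n * det (mat n n (\<lambda>(i,j). f i j))"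
proof -
  have "mat n n (\<lambda>(i,j). c * f i j) = c \<cdot>\<^sub>m mat n n (\<lambda>(i,j). f i j)"
    by (rule eq_matI) auto
  then show ?thesis by (simp add: det_smult)
qed

lemma sum_symmetric_around:
  fixes f :: "nat \<Rightarrow> 'a :: comm_semiring_1"
  shows "(\<Sum>k\<le>i+j. f k) = f i + (\<Sum>s=1..j. f (i + s)) + (\<Sum>s=1..i. f (i - s))"
proof -
  have "(\<Sum>k\<le>i+j. f k) = (\<Sum>k<i. f k) + (\<Sum>k=i..i+j. f k)"
    by (subst sum.union_disjoint[symmetric]) (auto intro!: sum.cong)
  also have "(\<Sum>k=i..i+j. f k) = f i + (\<Sum>k=Suc i..i+j. f k)"
    by (subst sum.atLeast_Suc_atMost) auto
  also have "(\<Sum>k=Suc i..i+j. f k) = (\<Sum>s=1..j. f (i + s))"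
    by (rule sum.reindex_bij_witness[of _ "\<lambda>s. i + s" "\<lambda>k. k - i"]) auto
  also have "(\<Sum>k<i. f k) = (\<Sum>s=1..i. f (i - s))"
    by (rule sum.reindex_bij_witness[of _ "\<lambda>s. i - s" "\<lambda>k. i - k"]) auto
  finally show ?thesis by (simp add: ac_simps)
qed

text \<open>Vandermonde's sum read outward from its term k = i: the terms at i+s and i-s agree by
  symmetry, hence the factor 2. The bound n gives both halves one range of s, on which the added
  terms vanish.\<close>

lemma central_binomial_add:
  assumes "i \<le> n" "j \<le> n"
  shows "(2*(i+j)) choose (i+j) = ((2*i) choose i) * ((2*j) choose j)
     + 2 * (\<Sum>s=1..n. ((2*i) choose (i+s)) * ((2*j) choose (j+s)))"
proof -
  let ?f = "\<lambda>k. ((2*i) choose k) * ((2*j) choose (i + j - k))"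
  let ?g = "\<lambda>s. ((2*i) choose (i+s)) * ((2*j) choose (j+s))"
  have ext: "(\<Sum>s=1..m. ?g s) = (\<Sum>s=1..n. ?g s)" if "m = i \<or> m = j" for m
    by (rule sum.mono_neutral_left) (use assms that in \<open>auto simp: binomial_eq_0\<close>)
  have sym: "(2*m) choose (m - s) = (2*m) choose (m + s)" if "s \<le> m" for m s :: nat
    using binomial_symmetric[of "m - s" "2*m"] that by (simp add: mult_2)
  have "(2*(i+j)) choose (i+j) = (\<Sum>k\<le>i+j. ?f k)"
    using vandermonde[of "2*i" "2*j" "i+j"] by (simp add: algebra_simps)
  also have "\<dots> = ?f i + (\<Sum>s=1..j. ?f (i + s)) + (\<Sum>s=1..i. ?f (i - s))"
    by (rule sum_symmetric_around)
  also have "(\<Sum>s=1..j. ?f (i + s)) = (\<Sum>s=1..j. ?g s)"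
    by (rule sum.cong) (auto simp: sym)
  also have "(\<Sum>s=1..i. ?f (i - s)) = (\<Sum>s=1..i. ?g s)"
    by (rule sum.cong) (auto simp: sym)
  finally show ?thesis using ext[of i] ext[of j] by simp
qed

lemma even_central_binomial:
  assumes "m > 0" shows "even ((2*m) choose m)"
proof -
  obtain k where m: "m = Suc k" using assms gr0_implies_Suc by blast
  have "(2*m) choose m = (Suc (2*k) choose k) + (Suc (2*k) choose Suc k)"
    by (simp add: m)
  also have "Suc (2*k) choose Suc k = Suc (2*k) choose k"
    using binomial_symmetric[of k "Suc (2*k)"] by (simp add: mult_2)
  finally show ?thesis by simp
qed

text \<open>The hypothesis fixes \<open>B\<close> only modulo 2, which is all that
  \<open>det_hankel_odd_multiple\<close> can supply and all that the parity of the determinant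
  depends on.\<close>

lemma odd_det_half_central_binomial:
  fixes B :: "int mat"
  assumes B: "B \<in> carrier_mat n n"
    and BC: "\<And>i j. i < n \<Longrightarrow> j < n \<Longrightarrow>
      [2 * B $$ (i,j) = int ((2 * (Suc i + Suc j)) choose (Suc i + Suc j))] (mod 4)"
  shows "odd (det B)"
proof -
  define N where "N = mat n n (\<lambda>(i,s). int ((2 * Suc i) choose (Suc i + Suc s)))"
  have N: "N \<in> carrier_mat n n" by (simp add: N_def)
  have diag: "N $$ (i,i) = 1" if "i < n" for i
    using that binomial_n_n[of "Suc i + Suc i"]
    by (simp only: N_def index_mat(1) prod.case mult_2 of_nat_1)
  have "det N = prod_list (diag_mat N)"
    by (rule det_lower_triangular[OF _ N]) (auto simp: N_def binomial_eq_0)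
  also have "\<dots> = 1"
    unfolding prod_list_diag_prod by (rule prod.neutral) (use N diag in auto)
  finally have detN: "det N = 1" .
  have "[det B = det (N * transpose_mat N)] (mod 2)"
  proof (rule det_cong[OF B])
    show "N * transpose_mat N \<in> carrier_mat n n" using N by simp
    fix i j assume ij: "i < n" "j < n"
    let ?b = "\<lambda>m. int ((2*m) choose m)"
    define S where "S = (N * transpose_mat N) $$ (i,j)"
    have "S = (\<Sum>s<n. int ((2 * Suc i) choose (Suc i + Suc s)) * int ((2 * Suc j) choose (Suc j + Suc s)))"
      using ij N by (simp add: S_def scalar_prod_def N_def lessThan_atLeast0)
    also have "\<dots> = (\<Sum>s=1..n. int ((2 * Suc i) choose (Suc i + s)) * int ((2 * Suc j) choose (Suc j + s)))"
      by (rule sum.reindex_bij_witness[of _ "\<lambda>s. s - 1" Suc]) auto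
    finally have "?b (Suc i + Suc j) = ?b (Suc i) * ?b (Suc j) + 2 * S"
      using ij central_binomial_add[of "Suc i" n "Suc j"] by simp
    \<comment> \<open>A product of two even numbers, so modulo 4 only the doubled sum
      \<open>2 * S\<close> survives.\<close>
    moreover have "[?b (Suc i) * ?b (Suc j) = 0] (mod 4)"
      using mult_dvd_mono[of 2 "?b (Suc i)" 2 "?b (Suc j)"]
        even_central_binomial[of "Suc i"] even_central_binomial[of "Suc j"]
      by (simp add: cong_0_iff)
    moreover have "2 dvd x - y" if "4 dvd 2 * x - (p + 2 * y)" "4 dvd p" for x y p :: int
      using that by presburger
    ultimately show "[B $$ (i,j) = (N * transpose_mat N) $$ (i,j)] (mod 2)"
      using BC[OF ij] unfolding S_def[symmetric] cong_iff_dvd_diff diff_0_right by metis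
  qed
  moreover have "det (N * transpose_mat N) = 1"
    using det_mult[OF N, of "transpose_mat N"] N detN by (simp add: det_transpose[OF N])
  ultimately show ?thesis by (simp add: cong_def odd_iff_mod_2_eq_one)
qed

text \<open>\<open>r\<close> is the odd part of the common factor: 3 for the Domb numbers, 1 for the
  squares of \<open>aerated\<close>. The entries of the reduced matrix involve \<open>a m\<close>
  only for m >= 2 modulo 8, and at m = 1 the congruence fails for those squares (0 against
  4).\<close>

lemma det_hankel_odd_multiple:
  fixes a :: "nat \<Rightarrow> int" and r :: int
  assumes a0: "a 0 = 1" and "odd r"
    and dvd: "\<And>i j. i > 0 \<Longrightarrow> j > 0 \<Longrightarrow> r dvd a (i + j) - a i * a j"
    and a4: "\<And>m. m > 0 \<Longrightarrow> 4 dvd a m"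
    and a8: "\<And>m. m \<ge> 2 \<Longrightarrow> [a m = 2 * int ((2*m) choose m)] (mod 8)"
  shows "\<exists>k. odd k \<and> det (hankel a n) = (4 * r) ^ n * k"
proof -
  let ?E = "\<lambda>i j. a (Suc i + Suc j) - a (Suc i) * a (Suc j)"
  have prod: "16 dvd a (Suc i) * a (Suc j)" for i j
    using mult_dvd_mono[OF a4 a4, of "Suc i" "Suc j"] by simp
  have "coprime 4 r" using coprime_power_left_iff[of 2 2 r] \<open>odd r\<close> by simp
  moreover have "4 dvd ?E i j" for i j
    using a4[of "Suc i + Suc j"] prod[of i j] by presburger
  ultimately have "4 * r dvd ?E i j" for i j
    using dvd[of "Suc i" "Suc j"] by (intro divides_mult) auto
  then have "\<forall>i j. \<exists>e. ?E i j = 4 * r * e" by (simp add: dvd_def)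
  then obtain e where e: "?E i j = 4 * r * e i j" for i j by metis
  have "odd (det (mat n n (\<lambda>(i,j). e i j)))"
  proof (rule odd_det_half_central_binomial)
    fix i j assume ij: "i < n" "j < n"
    define b where "b = int ((2 * (Suc i + Suc j)) choose (Suc i + Suc j))"
    obtain r' where r': "r = 2 * r' + 1" using \<open>odd r\<close> by (elim oddE)
    \<comment> \<open>Since \<open>r\<close> is odd, multiplying \<open>4 * e i j\<close> by it
      changes nothing modulo 8.\<close>
    have r'_e: "4 * r * e i j = 8 * (r' * e i j) + 4 * e i j" by (simp add: r' algebra_simps)
    have "[a (Suc i + Suc j) = 2 * b] (mod 8)"
      unfolding b_def by (rule a8) simp
    then have "[4 * r * e i j = 2 * b] (mod 8)"
      unfolding e[symmetric] cong_iff_dvd_diff using prod[of i j] by presburger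
    moreover have "4 dvd 2 * x - b" if "8 dvd 8 * y + 4 * x - 2 * b" for x y
      using that by presburger
    ultimately have "[2 * e i j = b] (mod 4)"
      unfolding cong_iff_dvd_diff r'_e by blast
    then show "[2 * mat n n (\<lambda>(i,j). e i j) $$ (i,j) = b] (mod 4)" using ij by simp
  qed simp
  moreover have "det (hankel a n) = (4 * r) ^ n * det (mat n n (\<lambda>(i,j). e i j))"
    unfolding det_hankel_split[of a, OF a0] e by (rule det_mat_smult)
  ultimately show ?thesis by blast
qed

section \<open>Congruences for Domb numbers and central binomial coefficients\<close>

lemma sum_symmetric:
  fixes f :: "nat \<Rightarrow> 'a :: comm_semiring_1"
  assumes sym: "\<And>k. k \<le> m \<Longrightarrow> f (m - k) = f k"
  shows "(\<Sum>k\<le>m. f k) = 2 * (\<Sum>k<(m + 1) div 2. f k) + (if even m then f (m div 2) else 0)"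
proof -
  have "(\<Sum>k\<le>m. f k) = (\<Sum>k<(m + 1) div 2. f k) + (\<Sum>k=(m + 1) div 2..m. f k)"
    by (subst sum.union_disjoint[symmetric]) (auto intro!: sum.cong)
  also have "(\<Sum>k=(m + 1) div 2..m. f k) = (\<Sum>k\<le>m div 2. f k)"
    by (rule sum.reindex_bij_witness[of _ "\<lambda>k. m - k" "\<lambda>k. m - k"]) (auto simp: sym)
  also have "\<dots> = (\<Sum>k<(m + 1) div 2. f k) + (if even m then f (m div 2) else 0)"
  proof (cases "even m")
    case True
    then have "(m + 1) div 2 = m div 2" by presburger
    then show ?thesis using True by (simp flip: lessThan_Suc_atMost)
  next
    case False
    then have "(m + 1) div 2 = Suc (m div 2)" by presburger
    then show ?thesis using False by (simp only: lessThan_Suc_atMost) simp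
  qed
  finally show ?thesis by (simp add: mult_2 ac_simps)
qed

section \<open>Aerated central binomial coefficients: constant terms of (x + 1/x)^m\<close>

definition aerated :: "nat \<Rightarrow> int" where
  "aerated m = (if even m then int (m choose (m div 2)) else 0)"

lemma even_aerated:
  assumes "m > 0" shows "even (aerated m)"
proof (cases "even m")
  case True
  then obtain q where "m = 2 * q" by (elim evenE)
  then show ?thesis using even_central_binomial[of q] assms by (simp add: aerated_def)
qed (simp add: aerated_def)

text \<open>Fold the sums of C(m,k) and of C(m,k)^2 about the middle. The half sums \<open>S\<close>
  and \<open>T\<close> have equal parity, while 2^m and the squared middle term vanish modulo 4, so
  both sides are congruent to 2S.\<close>

lemma aerated_cong_central_binomial:
  assumes "m \<ge> 2"
  shows "[aerated m = int ((2*m) choose m)] (mod 4)"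
proof -
  define h where "h = (m + 1) div 2"
  define S T where "S = (\<Sum>k<h. int (m choose k))" and "T = (\<Sum>k<h. int (m choose k)^2)"
  have sym: "m choose (m - k) = m choose k" if "k \<le> m" for k
    using binomial_symmetric[OF that] by simp
  have "2 ^ m = (\<Sum>k\<le>m. int (m choose k))"
    using choose_row_sum[of m] by (simp flip: of_nat_sum)
  also have "\<dots> = 2 * S + aerated m"
    unfolding S_def h_def aerated_def by (subst sum_symmetric) (auto simp: sym)
  finally have 1: "2 * S + aerated m = 2 ^ m" by simp
  have "int ((2*m) choose m) = (\<Sum>k\<le>m. int (m choose k)^2)"
    using choose_square_sum[of m] by (simp flip: of_nat_sum of_nat_power)
  also have "\<dots> = 2 * T + (aerated m)^2"
    unfolding T_def h_def aerated_def by (subst sum_symmetric) (auto simp: sym)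
  finally have 2: "int ((2*m) choose m) = 2 * T + (aerated m)^2" .
  have "even (T - S)"
    unfolding T_def S_def sum_subtractf[symmetric] by (rule dvd_sum) simp
  then have 3: "4 dvd 2 * (T - S)" by presburger
  have 4: "4 dvd (aerated m)^2" 
    using even_aerated[of m] assms by (auto elim!: evenE)
  have 5: "(4::int) dvd 2 ^ m" using le_imp_power_dvd[of 2 m "2::int"] assms by simp
  have 6: "even (aerated m)" using even_aerated[of m] assms by simp
  show ?thesis
    unfolding 2 cong_iff_dvd_diff using 1 3 4 5 6 by presburger
qed

text \<open>With \<open>aerated m = 2 * t\<close>, squaring agrees with doubling modulo 8 because
  t^2 - t is even; doubling lifts the congruence from modulus 4 to modulus 8.\<close>

lemma aerated_square_cong:
  assumes "m \<ge> 2"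
  shows "[(aerated m)^2 = 2 * int ((2*m) choose m)] (mod 8)"
proof -
  obtain t where t: "aerated m = 2 * t" using even_aerated[of m] assms by (auto elim!: evenE)
  have "even (t ^ 2 - t)" by simp
  then have "8 dvd 4 * t ^ 2 - 4 * t" by presburger
  moreover have "4 dvd 2 * t - int ((2*m) choose m)"
    using aerated_cong_central_binomial[OF assms] by (simp add: t cong_iff_dvd_diff)
  ultimately show ?thesis
    unfolding t cong_iff_dvd_diff power_mult_distrib by simp presburger
qed

section \<open>Domb numbers modulo 8\<close>

lemma domb_eq: "domb m = (\<Sum>k\<le>m. int ((m choose k)^2 * ((2*k) choose k) * ((2*(m-k)) choose (m-k))))"
  unfolding domb_def atLeast0AtMost ..

text \<open>The terms k = 0 and k = m give the right-hand side. Every other pair contributes twice a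
  multiple of 4, and a middle term is C(2q,q)^4 with C(2q,q) even.\<close>

lemma domb_cong_8:
  assumes "m > 0"
  shows "[domb m = 2 * int ((2*m) choose m)] (mod 8)"
proof -
  let ?f = "\<lambda>k. int ((m choose k)^2 * ((2*k) choose k) * ((2*(m-k)) choose (m-k)))"
  define h where "h = (m + 1) div 2"
  have h: "h > 0" using assms by (simp add: h_def)
  have dvd: "4 dvd ?f k" if "0 < k" "k < m" for k
  proof -
    have "4 dvd ((2*k) choose k) * ((2*(m-k)) choose (m-k))"
      using mult_dvd_mono[of 2 "(2*k) choose k" 2 "(2*(m-k)) choose (m-k)"]
        even_central_binomial[of k] even_central_binomial[of "m-k"] that by simp
    then have "4 dvd (m choose k)^2 * ((2*k) choose k) * ((2*(m-k)) choose (m-k))"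
      unfolding mult.assoc by (rule dvd_mult)
    then show ?thesis by (metis of_nat_dvd_iff of_nat_numeral)
  qed
  have "domb m = 2 * (\<Sum>k<h. ?f k) + (if even m then ?f (m div 2) else 0)"
    unfolding domb_eq h_def
    by (subst sum_symmetric) (auto simp: binomial_symmetric[symmetric] ac_simps)
  also have "(\<Sum>k<h. ?f k) = int ((2*m) choose m) + (\<Sum>k\<in>{..<h}-{0}. ?f k)"
    using h by (subst sum.remove[of _ 0]) auto
  finally have 1: "domb m = 2 * int ((2*m) choose m) + 2 * (\<Sum>k\<in>{..<h}-{0}. ?f k)
    + (if even m then ?f (m div 2) else 0)" by simp
  have 2: "4 dvd (\<Sum>k\<in>{..<h}-{0}. ?f k)"
    by (rule dvd_sum, rule dvd) (auto simp: h_def)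
  have 3: "8 dvd (if even m then ?f (m div 2) else 0)"
  proof (cases "even m")
    case True
    then obtain q where q: "m = 2 * q" by (elim evenE)
    then obtain t where t: "(2*q) choose q = 2 * t"
      using even_central_binomial[of q] assms by (auto elim!: evenE)
    have "m div 2 = q" "m - q = q" "m choose q = 2 * t" by (simp_all add: q flip: t)
    then have "?f (m div 2) = 8 * int (2 * t ^ 4)"
      by (simp add: t power2_eq_square power4_eq_xxxx)
    then show ?thesis using True by (simp only: if_True dvd_triv_left)
  qed simp
  show ?thesis
    unfolding 1 cong_iff_dvd_diff using 2 3 by presburger
qed

section \<open>Domb numbers modulo 3\<close>

lemma dvd_3_sum_cyclic:
  fixes f :: "nat \<Rightarrow> nat \<Rightarrow> nat \<Rightarrow> nat"
  assumes cyc: "\<And>a b c. f b c a = f a b c"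
    and diag: "\<And>a. 3 * a = k \<Longrightarrow> 3 dvd f a a a"
  shows "3 dvd (\<Sum>(a,b,c) | a + b + c = k. f a b c)"
proof -
  define S where "S = {(a,b,c). a + b + c = (k::nat)}"
  have fin: "finite S"
    by (rule finite_subset[of _ "{..k} \<times> {..k} \<times> {..k}"]) (auto simp: S_def)
  let ?f = "\<lambda>(a,b,c). f a b c"
  \<comment> \<open>In \<open>A\<close>, \<open>B\<close>, \<open>C\<close> the minimum sits at the first, second, third position and its cyclic successor
    is larger; this picks one position also when the minimum is attained twice.\<close>
  define A where "A = {(a,b,c)\<in>S. a < b \<and> a \<le> c}"
  define B where "B = {(a,b,c)\<in>S. b < c \<and> b \<le> a}"
  define C where "C = {(a,b,c)\<in>S. c < a \<and> c \<le> b}"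
  define D where "D = {(a,b,c)\<in>S. a = b \<and> b = c}"
  have sub: "finite A" "finite B" "finite C" "finite D"
    using fin by (auto simp: A_def B_def C_def D_def intro: finite_subset[rotated])
  have "S = A \<union> B \<union> C \<union> D" by (auto simp: A_def B_def C_def D_def)
  moreover have "A \<inter> B = {}" "(A \<union> B) \<inter> C = {}" "(A \<union> B \<union> C) \<inter> D = {}"
    by (auto simp: A_def B_def C_def D_def)
  ultimately have "sum ?f S = sum ?f A + sum ?f B + sum ?f C + sum ?f D"
    using sub by (simp add: sum.union_disjoint)
  \<comment> \<open>Off the diagonal every orbit of the rotation has three elements, one each in
    \<open>A\<close>, \<open>B\<close> and \<open>C\<close>, so these contribute equally.\<close>
  moreover have "sum ?f B = sum ?f A"
    by (rule sum.reindex_bij_witness[of _ "\<lambda>(a,b,c). (c,a,b)" "\<lambda>(a,b,c). (b,c,a)"])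
      (auto simp: A_def B_def S_def cyc)
  moreover have "sum ?f C = sum ?f A"
    by (rule sum.reindex_bij_witness[of _ "\<lambda>(a,b,c). (b,c,a)" "\<lambda>(a,b,c). (c,a,b)"])
      (auto simp: A_def C_def S_def cyc)
  moreover have "3 dvd sum ?f D"
    by (rule dvd_sum) (auto simp: D_def S_def intro!: diag)
  ultimately have "3 dvd sum ?f S" by presburger
  then show ?thesis by (simp add: S_def)
qed

text \<open>The left side sums the squared trinomial coefficients; for fixed a, the sum over b is a
  central binomial coefficient.\<close>

lemma trinomial_square_sum:
  "(\<Sum>(a,b,c) | a + b + c = k. (((a+b+c) choose a) * ((b+c) choose b))^2)
   = (\<Sum>a\<le>k. (k choose a)^2 * ((2*(k-a)) choose (k-a)))"
proof -
  have "(\<Sum>a\<le>k. (k choose a)^2 * ((2*(k-a)) choose (k-a)))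
    = (\<Sum>a\<le>k. \<Sum>b\<le>k-a. ((k choose a) * ((k-a) choose b))^2)"
    by (simp add: choose_square_sum[symmetric] sum_distrib_left power_mult_distrib)
  also have "\<dots> = (\<Sum>(a,b)\<in>(SIGMA a:{..k}. {..k-a}). ((k choose a) * ((k-a) choose b))^2)"
    by (rule sum.Sigma) auto
  also have "\<dots> = (\<Sum>(a,b,c) | a + b + c = k. (((a+b+c) choose a) * ((b+c) choose b))^2)"
    by (rule sum.reindex_bij_witness[of _ "\<lambda>(a,b,c). (a,b)" "\<lambda>(a,b). (a,b,k-a-b)"]) auto
  finally show ?thesis by simp
qed

text \<open>Multiplied by a! b! c!, both sides become (a+b+c)!.\<close>

lemma trinomial_cyclic:
  "((b+c+a) choose b) * ((c+a) choose c) = ((a+b+c) choose a) * ((b+c) choose (b::nat))"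
proof -
  have tri: "((x+y+z) choose x) * ((y+z) choose y) * (fact x * fact y * fact z) = (fact (x+y+z) :: nat)"
    for x y z :: nat
  proof -
    have "((x+y+z) choose x) * ((y+z) choose y) * (fact x * fact y * fact z)
      = (fact x * (fact y * fact z * ((y+z) choose y)) * ((x+y+z) choose x) :: nat)" by simp
    also have "fact y * fact z * ((y+z) choose y) = (fact (y+z) :: nat)"
      using binomial_fact_lemma[of y "y+z"] by simp
    also have "fact x * fact (y+z) * ((x+y+z) choose x) = (fact (x+y+z) :: nat)"
      using binomial_fact_lemma[of x "x+y+z"] by (simp add: add.assoc)
    finally show ?thesis .
  qed
  have "((b+c+a) choose b) * ((c+a) choose c) * (fact a * fact b * fact c)
     = ((a+b+c) choose a) * ((b+c) choose b) * (fact a * fact b * (fact c :: nat))"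
    using tri[of b c a] tri[of a b c] by (simp add: ac_simps)
  then show ?thesis by simp
qed

lemma dvd_3_trinomial:
  assumes "a > 0" shows "3 dvd (3 * a) choose a"
proof -
  have "a * ((3*a) choose a) = (3*a) * ((3*a-1) choose (a-1))"
    using times_binomial_minus1_eq[OF assms, of "3*a"] by simp
  then have "(3*a) choose a = 3 * ((3*a-1) choose (a-1))" using assms by simp
  then show ?thesis by simp
qed

text \<open>Expanding C(2k,k) as a sum of C(k,l)^2 and using C(m,k) C(k,l) = C(m,l) C(m-l,k-l)
  regroups the Domb number by l. The inner sums \<open>T (m-l)\<close> are divisible by 3 except at
  l = m, which contributes 1.\<close>

lemma domb_cong_3: "[domb m = 1] (mod 3)"
proof -
  define T where "T k = (\<Sum>a\<le>k. (k choose a)^2 * ((2*(k-a)) choose (k-a)))" for k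
  have T: "3 dvd T k" if "k > 0" for k
  proof -
    have "3 dvd (\<Sum>(a,b,c) | a + b + c = k. (((a+b+c) choose a) * ((b+c) choose b))^2)"
    proof (rule dvd_3_sum_cyclic)
      fix a assume "3 * a = k"
      then have "3 dvd (a+a+a) choose a" using that dvd_3_trinomial[of a] by (simp add: numeral_3_eq_3 add.assoc)
      then show "3 dvd (((a+a+a) choose a) * ((a+a) choose a))^2"
        by (simp add: power2_eq_square)
    qed (use trinomial_cyclic in simp)
    then show ?thesis by (simp add: T_def trinomial_square_sum)
  qed
  have "(\<Sum>k\<le>m. (m choose k)^2 * ((2*k) choose k) * ((2*(m-k)) choose (m-k)))
     = (\<Sum>k\<le>m. \<Sum>l\<le>k. (m choose k)^2 * (k choose l)^2 * ((2*(m-k)) choose (m-k)))"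
  proof (rule sum.cong[OF refl])
    fix k
    show "(m choose k)^2 * ((2*k) choose k) * ((2*(m-k)) choose (m-k))
      = (\<Sum>l\<le>k. (m choose k)^2 * (k choose l)^2 * ((2*(m-k)) choose (m-k)))"
      unfolding choose_square_sum[of k, symmetric] sum_distrib_left sum_distrib_right ..
  qed
  also have "\<dots> = (\<Sum>k\<le>m. \<Sum>l\<le>k. (m choose l)^2 * (((m-l) choose (k-l))^2 * ((2*(m-k)) choose (m-k))))"
    by (intro sum.cong refl)
      (simp add: choose_mult power_mult_distrib[symmetric] flip: mult.assoc)
  also have "\<dots> = (\<Sum>l\<le>m. \<Sum>k=l..m. (m choose l)^2 * (((m-l) choose (k-l))^2 * ((2*(m-k)) choose (m-k))))"
    unfolding sum.Sigma[OF finite_atMost ballI[OF finite_atMost]] sum.Sigma[OF finite_atMost ballI[OF finite_atLeastAtMost]]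
    by (rule sum.reindex_bij_witness[of _ "\<lambda>(l,k). (k,l)" "\<lambda>(k,l). (l,k)"]) auto
  also have "\<dots> = (\<Sum>l\<le>m. (m choose l)^2 * T (m-l))"
  proof (rule sum.cong)
    fix l assume l: "l \<in> {..m}"
    have "(\<Sum>k=l..m. ((m-l) choose (k-l))^2 * ((2*(m-k)) choose (m-k))) = T (m-l)"
      unfolding T_def
      by (rule sum.reindex_bij_witness[of _ "\<lambda>k. k + l" "\<lambda>k. k - l"]) (use l in auto)
    then show "(\<Sum>k=l..m. (m choose l)^2 * (((m-l) choose (k-l))^2 * ((2*(m-k)) choose (m-k))))
      = (m choose l)^2 * T (m-l)" by (simp add: sum_distrib_left[symmetric])
  qed simp
  also have "\<dots> = 1 + (\<Sum>l<m. (m choose l)^2 * T (m-l))"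
    by (simp add: lessThan_Suc_atMost[symmetric]) (simp add: T_def)
  finally have "domb m = 1 + int (\<Sum>l<m. (m choose l)^2 * T (m-l))"
    unfolding domb_eq of_nat_sum[symmetric] by simp
  moreover have "3 dvd (\<Sum>l<m. (m choose l)^2 * T (m-l))"
    by (rule dvd_sum) (simp add: T)
  then have "3 dvd int (\<Sum>l<m. (m choose l)^2 * T (m-l))"
    by (metis of_nat_dvd_iff of_nat_numeral)
  ultimately show ?thesis by (simp add: cong_iff_dvd_diff del: of_nat_sum)
qed

section \<open>Catalan--Larcombe--French numbers as a binomial transform\<close>

lemma central_binomial_Suc:
  "Suc m * ((2 * Suc m) choose Suc m) = 2 * (2*m+1) * ((2*m) choose m)"
proof -
  have "Suc m * ((2 * Suc m) choose Suc m) = 2 * Suc m * (Suc (2*m) choose m)"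
    using Suc_times_binomial_eq[of "Suc (2*m)" m] by (simp add: algebra_simps)
  moreover have "Suc m * (Suc (2*m) choose m) = (2*m+1) * ((2*m) choose m)"
    using binomial_absorb_comp[of "Suc (2*m)" m] by (simp add: mult_2 algebra_simps)
  ultimately show ?thesis by (metis mult.assoc mult.left_commute)
qed

text \<open>Since \<open>1 / C(n,k) = k! (n-k)! / n!\<close>, the square of this series is \<open>\<Sum>\<^sub>n n! P\<^sub>n X\<^sup>n\<close>; the recurrence
  for \<open>P\<^sub>n\<close> is the symmetric square of the differential equation below.\<close>

definition clf_fps :: "rat fps" where
  "clf_fps = Abs_fps (\<lambda>k. fact k * (of_nat ((2*k) choose k))^2)"

lemma fps_nth_numeral_mult: "fps_nth (numeral c * f) n = numeral c * fps_nth f n"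
  by (simp add: numeral_fps_const)

lemma fps_X_mult_nth_Suc: "fps_nth (fps_X * f) (Suc n) = fps_nth f n"
  for f :: "'a :: semiring_1 fps"
  by simp

text \<open>These rules turn differential equations with polynomial coefficients into
  recurrences.\<close>

lemma fps_nth_X_power_deriv:
  fixes f :: "'a :: comm_ring_1 fps"
  shows "fps_nth (fps_X * fps_deriv f) n = of_nat n * fps_nth f n" (is ?th1)
    and "fps_nth (fps_X^2 * fps_deriv (fps_deriv f)) n = of_nat n * (of_nat n - 1) * fps_nth f n" (is ?th2)
    and "fps_nth (fps_X^3 * fps_deriv (fps_deriv (fps_deriv f))) n
      = of_nat n * (of_nat n - 1) * (of_nat n - 2) * fps_nth f n" (is ?th3)
proof -
  show ?th1 by (cases n) auto
  show ?th2
  proof (cases "n < 2")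
    case True
    then have "n = 0 \<or> n = 1" by auto
    then show ?thesis by (auto simp: fps_X_power_mult_nth)
  next
    case False
    then obtain k where "n = k + 2" by (metis le_add_diff_inverse2 not_less)
    then show ?thesis by (simp add: fps_X_power_mult_nth algebra_simps numeral_2_eq_2)
  qed
  show ?th3
  proof (cases "n < 3")
    case True
    then have "n = 0 \<or> n = 1 \<or> n = 2" by auto
    then show ?thesis by (auto simp: fps_X_power_mult_nth)
  next
    case False
    then obtain k where "n = k + 3" by (metis le_add_diff_inverse2 not_less)
    then show ?thesis by (simp add: fps_X_power_mult_nth algebra_simps numeral_3_eq_3)
  qed
qed

text \<open>Coefficientwise this is k! times the square of the relation (k+1) b(k+1) = 2(2k+1) b(k)
  for central binomial coefficients.\<close>

lemma clf_fps_ode: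
  "16 * fps_X^2 * fps_deriv (fps_deriv clf_fps) + (32 * fps_X - 1) * fps_deriv clf_fps
     + 4 * clf_fps = 0" (is "?L = 0")
proof (rule fps_ext)
  fix k
  define b where "b k = (of_nat ((2*k) choose k) :: rat)" for k
  have "of_nat (Suc k) * b (Suc k) = of_nat (Suc k * ((2 * Suc k) choose Suc k))"
    unfolding b_def of_nat_mult ..
  also have "\<dots> = 2 * (2 * of_nat k + 1) * b k"
    unfolding central_binomial_Suc b_def by (simp add: algebra_simps)
  finally have b: "(of_nat k + 1) * b (Suc k) = 2 * (2 * of_nat k + 1) * b k" by (simp add: add.commute)
  have nth: "fps_nth clf_fps k = fact k * (b k)^2" for k
    by (simp add: clf_fps_def b_def)
  have "?L = 16 * (fps_X^2 * fps_deriv (fps_deriv clf_fps)) + 32 * (fps_X * fps_deriv clf_fps)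
      - fps_deriv clf_fps + 4 * clf_fps" by (simp add: algebra_simps)
  then have "fps_nth ?L k = (16 * of_nat k * (of_nat k - 1) + 32 * of_nat k + 4) * fps_nth clf_fps k
      - of_nat (Suc k) * fps_nth clf_fps (Suc k)"
    by (simp only: fps_nth_numeral_mult fps_nth_X_power_deriv fps_add_nth fps_sub_nth fps_deriv_nth)
      (simp add: algebra_simps)
  also have "\<dots> = fact k * ((2 * (2 * of_nat k + 1) * b k)^2 - ((of_nat k + 1) * b (Suc k))^2)"
    unfolding nth by (simp add: power2_eq_square algebra_simps)
  also have "\<dots> = 0" by (simp add: b)
  finally show "fps_nth ?L k = fps_nth 0 k" by simp
qed

lemma clf_recurrence:
  "(of_nat n + 2)^2 * clf (n + 2) = 8 * (3 * (of_nat n + 1)^2 + 3 * (of_nat n + 1) + 1) * clf (n + 1)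
     - 128 * (of_nat n + 1)^2 * clf n"
proof -
  define A where "A = clf_fps"
  define W where "W = A ^ 2"
  have W: "fps_nth W n = fact n * clf n" for n
    unfolding W_def A_def clf_fps_def power2_eq_square fps_mult_nth clf_def sum_distrib_left
  proof (rule sum.cong)
    fix k assume "k \<in> {0..n}"
    then have "of_nat (n choose k) = (fact n / (fact k * fact (n-k)) :: rat)"
      by (simp add: binomial_fact)
    then show "fps_nth (Abs_fps (\<lambda>k. fact k * (of_nat (2 * k choose k) * of_nat (2 * k choose k)))) k *
        fps_nth (Abs_fps (\<lambda>k. fact k * (of_nat (2 * k choose k) * of_nat (2 * k choose k)))) (n - k)
      = fact n * (of_nat ((2 * k choose k) * (2 * k choose k) * ((2 * (n - k) choose (n - k))
          * (2 * (n - k) choose (n - k)))) / of_nat (n choose k) :: rat)"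
      by (simp only: fps_nth_Abs_fps of_nat_mult) simp
  qed simp
  define E where "E = 16 * fps_X^2 * fps_deriv (fps_deriv A) + (32 * fps_X - 1) * fps_deriv A + 4 * A"
  have E: "E = 0" unfolding E_def A_def by (rule clf_fps_ode)
  have dX: "fps_deriv (fps_X ^ 2) = (2 * fps_X :: rat fps)" by (simp add: power2_eq_square)
  have dn: "fps_deriv (numeral k) = (0 :: rat fps)" for k
    by (simp add: numeral_fps_const)
  have dE: "fps_deriv E = 16 * fps_X^2 * fps_deriv (fps_deriv (fps_deriv A))
      + (64 * fps_X - 1) * fps_deriv (fps_deriv A) + 36 * fps_deriv A"
    unfolding E_def by (simp add: dX dn algebra_simps)
  define A1 A2 A3 W1 W2 W3 where "A1 = fps_deriv A" and "A2 = fps_deriv A1"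
    and "A3 = fps_deriv A2" and "W1 = fps_deriv W" and "W2 = fps_deriv W1" and "W3 = fps_deriv W2"
  have W1: "W1 = 2 * A * A1"
    by (simp add: W1_def W_def A1_def power2_eq_square)
  have W2: "W2 = 2 * A1^2 + 2 * A * A2"
    unfolding W2_def W1 by (simp add: A1_def[symmetric] A2_def power2_eq_square algebra_simps)
  have W3: "W3 = 6 * A1 * A2 + 2 * A * A3"
    unfolding W3_def W2
    by (simp add: A1_def[symmetric] A2_def[symmetric] A3_def power2_eq_square algebra_simps)
  \<comment> \<open>The multipliers of \<open>fps_deriv E\<close> and \<open>E\<close> are chosen so
    that A A3 and A1 A2 occur in ratio 1:3, and A A2 and A1^2 in ratio 1:1. These are the ratios in
    \<open>W3\<close> and \<open>W2\<close>, so everything is expressible through \<open>W\<close>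
    and its derivatives.\<close>
  have "256 * fps_X^4 * W3 + 48 * fps_X^2 * (32 * fps_X - 1) * W2
      + (1792 * fps_X^2 - 96 * fps_X + 2) * W1 + (256 * fps_X - 16) * W
    = 32 * fps_X^2 * A * fps_deriv E + 96 * fps_X^2 * A1 * E + 4 * (16 * fps_X - 1) * A * E"
    unfolding dE A1_def[symmetric] A2_def[symmetric] A3_def[symmetric] W3 W2 W1
    unfolding E_def W_def A1_def[symmetric] A2_def[symmetric]
    by (simp add: algebra_simps power2_eq_square power4_eq_xxxx)
  also have "\<dots> = 0" by (simp add: E)
  finally have "256 * (fps_X * (fps_X^3 * W3)) + 1536 * (fps_X * (fps_X^2 * W2))
      - 48 * (fps_X^2 * W2) + 1792 * (fps_X * (fps_X * W1)) - 96 * (fps_X * W1) + 2 * W1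
      + 256 * (fps_X * W) - 16 * W = 0"
    by (simp add: algebra_simps eval_nat_numeral)
  note this[unfolded W3_def W2_def W1_def]
  from arg_cong[OF this, of "\<lambda>F. fps_nth F (Suc n)"]
  have "256 * (of_nat n + 1)^3 * fps_nth W n
      - 16 * (3 * (of_nat n + 1)^2 + 3 * (of_nat n + 1) + 1) * fps_nth W (Suc n)
      + 2 * (of_nat n + 2) * fps_nth W (Suc (Suc n)) = 0"
    by (simp only: fps_nth_numeral_mult fps_nth_X_power_deriv fps_add_nth fps_sub_nth
        fps_X_mult_nth_Suc fps_deriv_nth)
      (simp add: algebra_simps power2_eq_square power3_eq_cube)
  then have "fact n * (of_nat n + 1) * (256 * (of_nat n + 1)^2 * clf n
      - 16 * (3 * (of_nat n + 1)^2 + 3 * (of_nat n + 1) + 1) * clf (n + 1)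
      + 2 * (of_nat n + 2)^2 * clf (n + 2)) = 0"
    unfolding W by (simp add: algebra_simps power2_eq_square power3_eq_cube)
  moreover have "(of_nat n + 1 :: rat) \<noteq> 0" by (metis of_nat_Suc of_nat_neq_0 add.commute)
  ultimately have "256 * (of_nat n + 1)^2 * clf n
      - 16 * (3 * (of_nat n + 1)^2 + 3 * (of_nat n + 1) + 1) * clf (n + 1)
      + 2 * (of_nat n + 2)^2 * clf (n + 2) = 0"
    unfolding mult_eq_0_iff using fact_nonzero by blast
  then show ?thesis by (simp add: algebra_simps)
qed

section \<open>The same recurrence for the rescaled binomial transform\<close>

definition clf_aux :: "nat \<Rightarrow> rat" where
  "clf_aux n = (\<Sum>m\<le>n. of_nat (n choose m) * (of_int (aerated m) / 2^m)^2)"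

text \<open>Telescoping certificate for \<open>\<Sum>\<^sub>m C(n,m) y\<^sub>m\<close> with \<open>(m+2)\<^sup>2 y\<^sub>m\<^sub>+\<^sub>2 = (m+1)\<^sup>2 y\<^sub>m\<close>.\<close>

lemma binomial_certificate:
  fixes n m :: nat
  defines "C \<equiv> \<lambda>n m. of_nat (n choose m) :: rat"
  shows "(of_nat m + 1)^2 * C (n+1) m - (of_nat m + 2)^2 * C (n+1) (m + 2)
   = (of_nat n + 2)^2 * C (n + 2) (m+1)
    - (3 * (of_nat n + 1)^2 + 3 * (of_nat n + 1) + 1) * C (n + 1) (m+1)
    + 2 * (of_nat n + 1)^2 * C n (m+1)"
proof -
  have absorb: "(of_nat k + 1) * C (N+1) (k+1) = (of_nat N + 1) * C N k" for N k
    using arg_cong[OF Suc_times_binomial_eq[of N k], of "of_nat :: nat \<Rightarrow> rat"]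
    by (simp add: C_def algebra_simps)
  have pascal: "C (N+1) (k+1) = C N k + C N (k+1)" for N k by (simp add: C_def)
  define x y c d where "x = (of_nat m :: rat)" and "y = (of_nat n :: rat)"
    and "c = C (n+1) (m+1)" and "d = C (n+2) (m+1)"
  have 1: "C (n+1) m = d - c" using pascal[of "n+1" m] by (simp add: c_def d_def)
  have 2: "(x + 1) * d = (y + 2) * (d - c)"
    using absorb[of m "n+1"] unfolding 1[symmetric] by (simp add: x_def y_def d_def algebra_simps)
  have 3: "(y + 1) * C n (m+1) = (y - x) * c"
    using absorb[of m n] pascal[of n m] by (simp add: x_def y_def c_def algebra_simps)
  have 4: "(x + 2) * C (n+1) (m+2) = (y - x) * c"
    using absorb[of "m+1" n] 3 by (simp add: x_def y_def algebra_simps)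
  have "(x + 1)^2 * (d - c) - (x + 2) * ((x + 2) * C (n+1) (m+2))
    = (y + 2)^2 * d - (3 * (y + 1)^2 + 3 * (y + 1) + 1) * c + 2 * (y + 1) * ((y + 1) * C n (m+1))"
    (is "?l = ?r")
  proof -
    \<comment> \<open>Relations 3 and 4 reduce both sides to \<open>c\<close> and \<open>d\<close>;
      the difference is then a multiple of relation 2.\<close>
    have "?r - ?l = (x + y + 3) * ((y + 2) * (d - c) - (x + 1) * d)"
      unfolding 3 4 by (simp add: algebra_simps power2_eq_square)
    then show ?thesis using 2 by simp
  qed
  then show ?thesis
    unfolding x_def[symmetric] y_def[symmetric] 1 c_def[symmetric] d_def[symmetric]
    by (simp add: power2_eq_square mult.assoc)
qed

lemma aerated_add_2:
  "(of_nat m + 2) * aerated (m + 2) = 4 * (of_nat m + 1) * aerated m"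
proof (cases "even m")
  case True
  then obtain q where q: "m = 2 * q" by (elim evenE)
  define B where "B = (2 * Suc q) choose Suc q"
  have "aerated (m + 2) = int B" by (simp add: aerated_def q B_def)
  then have "(of_nat m + 2) * aerated (m + 2) = 2 * int (Suc q * B)"
    by (simp add: q algebra_simps)
  also have "\<dots> = 4 * (of_nat m + 1) * aerated m"
    unfolding B_def central_binomial_Suc by (simp add: aerated_def q algebra_simps)
  finally show ?thesis .
qed (simp add: aerated_def)

lemma clf_aux_recurrence:
  "(of_nat n + 2)^2 * clf_aux (n + 2) = (3 * (of_nat n + 1)^2 + 3 * (of_nat n + 1) + 1) * clf_aux (n + 1)
     - 2 * (of_nat n + 1)^2 * clf_aux n"
proof -
  \<comment> \<open>The division by \<open>2^m\<close> absorbs the factor 16 in the two-step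
    recurrence of the squares of \<open>aerated\<close>.\<close>
  define y :: "nat \<Rightarrow> rat" where "y m = (of_int (aerated m) / 2^m)^2" for m
  define C where "C n m = (of_nat (n choose m) :: rat)" for n m
  define X where "X m = (of_nat n + 2)^2 * C (n + 2) m
    - (3 * (of_nat n + 1)^2 + 3 * (of_nat n + 1) + 1) * C (n + 1) m
    + 2 * (of_nat n + 1)^2 * C n m" for m
  have aux: "clf_aux k = (\<Sum>m\<le>n+2. C k m * y m)" if "k \<le> n + 2" for k
    unfolding clf_aux_def C_def y_def
    by (rule sum.mono_neutral_left) (use that in \<open>auto simp: binomial_eq_0\<close>)
  have y1: "y (Suc 0) = 0" by (simp add: y_def aerated_def)
  have y2: "(of_nat m + 2)^2 * y (m + 2) = (of_nat m + 1)^2 * y m" for m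
  proof -
    have *: "(of_nat m + 2) * of_int (aerated (m + 2)) = 4 * (of_nat m + 1) * (of_int (aerated m) :: rat)"
      using arg_cong[OF aerated_add_2[of m], of "of_int :: int \<Rightarrow> rat"] by simp
    have "(of_nat m + 2)^2 * y (m + 2) = ((of_nat m + 2) * of_int (aerated (m + 2)) / (4 * 2^m))^2"
      by (simp add: y_def power_mult_distrib power_divide power_add)
    also have "\<dots> = ((of_nat m + 1) * of_int (aerated m) / 2^m)^2"
      unfolding * by (simp add: mult.assoc del: distrib_left_numeral)
    also have "\<dots> = (of_nat m + 1)^2 * y m"
      by (simp add: y_def power_mult_distrib power_divide)
    finally show ?thesis .
  qed
  have X0: "X 0 = - C (n+1) 1" by (simp add: X_def C_def power2_eq_square algebra_simps)
  have XS: "X (Suc m) = (of_nat m + 1)^2 * C (n+1) m - (of_nat m + 2)^2 * C (n+1) (m + 2)" for m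
    using binomial_certificate[of m n] by (simp add: X_def C_def)
  \<comment> \<open>Both halves of the certificate sum to \<open>S\<close>: the first by the
    recurrence for \<open>y\<close>, the second by an index shift whose boundary term is cancelled
    by \<open>X 0 * y 0\<close>.\<close>
  define S where "S = (\<Sum>m\<le>n. (of_nat m + 1)^2 * C (n+1) (m+1) * y m)"
  have "(\<Sum>m\<le>n+1. (of_nat m + 1)^2 * C (n+1) m * y (Suc m))
    = (\<Sum>m\<le>n. C (n+1) (m+1) * ((of_nat m + 2)^2 * y (m + 2)))"
    by (simp add: sum.atMost_Suc_shift y1 mult_ac add_ac del: sum.atMost_Suc)
  also have "\<dots> = S" unfolding S_def y2 by (simp add: mult_ac)
  finally have S1: "(\<Sum>m\<le>n+1. (of_nat m + 1)^2 * C (n+1) m * y (Suc m)) = S" .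
  have "S = (\<Sum>m\<le>Suc (n+1). (of_nat m + 1)^2 * C (n+1) (m+1) * y m)"
    unfolding S_def by (rule sum.mono_neutral_left) (auto simp: C_def binomial_eq_0)
  also have "\<dots> = C (n+1) 1 * y 0 + (\<Sum>m\<le>n+1. (of_nat m + 2)^2 * C (n+1) (m+2) * y (Suc m))"
    by (subst sum.atMost_Suc_shift) (simp add: add_ac)
  finally have S2: "(\<Sum>m\<le>n+1. (of_nat m + 2)^2 * C (n+1) (m+2) * y (Suc m)) = S - C (n+1) 1 * y 0"
    by simp
  have "(of_nat n + 2)^2 * clf_aux (n + 2) - (3 * (of_nat n + 1)^2 + 3 * (of_nat n + 1) + 1) * clf_aux (n + 1)
     + 2 * (of_nat n + 1)^2 * clf_aux n = (\<Sum>m\<le>Suc (n+1). X m * y m)"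
    by (simp only: aux le_add1 le_add2 add_le_cancel_left one_le_numeral order_refl sum_distrib_left)
      (simp add: X_def sum.distrib sum_subtractf algebra_simps)
  also have "\<dots> = X 0 * y 0 + (\<Sum>m\<le>n+1. X (Suc m) * y (Suc m))"
    by (rule sum.atMost_Suc_shift)
  also have "\<dots> = 0"
    unfolding XS X0 left_diff_distrib sum_subtractf S1 S2 by simp
  finally show ?thesis by simp
qed

lemma clf_eq: "clf n = 8^n * clf_aux n"
proof (induction n rule: induct_nat_012)
  case 0 show ?case by (simp add: clf_def clf_aux_def aerated_def)
next
  case 1 show ?case by (simp add: clf_def clf_aux_def aerated_def atLeast0AtMost)
next
  case (ge2 n)
  let ?q = "3 * (of_nat n + 1)^2 + 3 * (of_nat n + 1) + 1 :: rat"
  have "(of_nat n + 2)^2 * clf (n + 2)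
    = 8 * ?q * (8^(n+1) * clf_aux (n+1)) - 128 * (of_nat n + 1)^2 * (8^n * clf_aux n)"
    using clf_recurrence[of n] ge2 by simp
  also have "\<dots> = 8^(n+2) * (?q * clf_aux (n+1) - 2 * (of_nat n + 1)^2 * clf_aux n)"
    by (simp add: power_add right_diff_distrib)
  also have "\<dots> = (of_nat n + 2)^2 * (8^(n+2) * clf_aux (n+2))"
    unfolding clf_aux_recurrence[symmetric] by simp
  finally have "(of_nat n + 2)^2 * clf (n + 2) = (of_nat n + 2)^2 * (8^(n+2) * clf_aux (n+2))" .
  moreover have "(of_nat (n + 2) :: rat) \<noteq> 0" unfolding of_nat_eq_0_iff by simp
  ultimately show ?case by simp
qed

section \<open>Positivity\<close>

lemma sum_powers_cis:
  assumes pq: "p < N" "q < N"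
  shows "(\<Sum>t<N. cis (2 * pi * real t / real N) ^ p * cnj (cis (2 * pi * real t / real N)) ^ q)
    = (if p = q then of_nat N else 0)"
proof -
  have N: "N > 0" using pq by simp
  define w where "w k = cis (2 * pi * real k / real N)" for k
  \<comment> \<open>Orthogonality of characters: the sum is geometric in \<open>z\<close>, with z^N
    = 1, and \<open>z\<close> differs from 1 when p and q do because the N roots are
    distinct.\<close>
  define z where "z = w p * cnj (w q)"
  have "(\<Sum>t<N. w t ^ p * cnj (w t) ^ q) = (\<Sum>t<N. z ^ t)"
    by (rule sum.cong) (simp_all add: z_def w_def power_mult_distrib DeMoivre cis_cnj mult_ac)
  also have "\<dots> = (if p = q then of_nat N else 0)"
  proof (cases "p = q")
    case True
    then have "z = 1" by (simp add: z_def w_def cis_cnj cis_mult)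
    then show ?thesis using True by simp
  next
    case False
    have "inj_on w {..<N}"
      using bij_betw_roots_unity[OF N] unfolding w_def bij_betw_def by blast
    then have neq: "w p \<noteq> w q" using False pq by (auto dest: inj_onD)
    have "z * w q = w p" by (simp add: z_def w_def cis_cnj cis_mult)
    then have "z \<noteq> 1" using neq by auto
    moreover have "w k ^ N = 1" for k
      using N by (simp add: w_def DeMoivre)
    then have "z ^ N = 1" by (simp add: z_def power_mult_distrib flip: complex_cnj_power)
    ultimately show ?thesis using False by (simp add: geometric_sum)
  qed
  finally show ?thesis by (simp add: w_def)
qed

text \<open>Parseval's identity for the polynomial \<open>(a + b \<zeta>)^m\<close>, with the circle replaced by the
  \<open>N\<close>-th roots of unity.\<close>

lemma sum_norm_power_roots_unity:
  assumes m: "m < N"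
  shows "(\<Sum>t<N. norm (a + b * cis (2 * pi * real t / real N)) ^ (2 * m))
     = real N * (\<Sum>k\<le>m. real (m choose k)^2 * norm b ^ (2 * k) * norm a ^ (2 * (m - k)))"
proof -
  define w where "w t = cis (2 * pi * real t / real N)" for t
  define c where "c k = of_nat (m choose k) * b ^ k * a ^ (m - k)" for k
  have norm2: "of_real (norm z ^ (2 * k)) = z ^ k * cnj z ^ k" for z k
  proof -
    have "of_real (norm z ^ (2 * k)) = (of_real (norm z ^ 2) :: complex) ^ k" by (simp add: power_mult)
    then show ?thesis unfolding complex_norm_square power_mult_distrib .
  qed
  have exp: "(a + b * w t) ^ m = (\<Sum>k\<le>m. c k * w t ^ k)" for t
    using binomial_ring[of "b * w t" a m] by (simp add: c_def power_mult_distrib mult_ac add.commute)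
  have "of_real (\<Sum>t<N. norm (a + b * w t) ^ (2 * m))
     = (\<Sum>t<N. (a + b * w t) ^ m * cnj ((a + b * w t) ^ m))"
    unfolding of_real_sum norm2 complex_cnj_power ..
  also have "\<dots> = (\<Sum>t<N. \<Sum>k\<le>m. \<Sum>l\<le>m. c k * cnj (c l) * (w t ^ k * cnj (w t) ^ l))"
    unfolding exp cnj_sum sum_product by (intro sum.cong refl) simp
  also have "\<dots> = (\<Sum>k\<le>m. \<Sum>t<N. \<Sum>l\<le>m. c k * cnj (c l) * (w t ^ k * cnj (w t) ^ l))"
    by (rule sum.swap)
  also have "\<dots> = (\<Sum>k\<le>m. \<Sum>l\<le>m. c k * cnj (c l) * (\<Sum>t<N. w t ^ k * cnj (w t) ^ l))"
    unfolding sum_distrib_left by (intro sum.cong refl sum.swap)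
  also have "\<dots> = (\<Sum>k\<le>m. \<Sum>l\<le>m. if l = k then of_nat N * (c k * cnj (c k)) else 0)"
    by (intro sum.cong refl) (use m in \<open>auto simp: w_def sum_powers_cis\<close>)
  also have "\<dots> = (\<Sum>k\<le>m. of_nat N * (c k * cnj (c k)))"
    by (intro sum.cong refl) (simp add: sum.delta)
  also have "\<dots> = of_real (real N * (\<Sum>k\<le>m. real (m choose k)^2 * norm b ^ (2 * k) * norm a ^ (2 * (m - k))))"
    unfolding of_real_mult of_real_sum sum_distrib_left norm2
    by (intro sum.cong refl) (simp add: c_def power2_eq_square)
  finally show ?thesis unfolding of_real_eq_iff w_def .
qed

text \<open>For moments of a discrete measure the form is a weighted sum of squares of the
  polynomial with coefficients \<open>x\<close> at the nodes. Moments up to 2n suffice, so the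
  measure may depend on n.\<close>

lemma hankel_form_nonneg:
  fixes a x :: "nat \<Rightarrow> int" and w l :: "'b \<Rightarrow> real"
  assumes w: "\<And>v. v \<in> I \<Longrightarrow> w v \<ge> 0"
    and a: "\<And>m. m \<le> 2 * n \<Longrightarrow> of_int (a m) = (\<Sum>v\<in>I. w v * l v ^ m)"
  shows "(\<Sum>i\<le>n. \<Sum>j\<le>n. x i * a (i + j) * x j) \<ge> 0"
proof -
  have "real_of_int (\<Sum>i\<le>n. \<Sum>j\<le>n. x i * a (i + j) * x j)
    = (\<Sum>i\<le>n. \<Sum>j\<le>n. \<Sum>v\<in>I. w v * ((of_int (x i) * l v ^ i) * (of_int (x j) * l v ^ j)))"
    unfolding of_int_sum of_int_mult
    by (intro sum.cong refl) (simp add: a sum_distrib_left sum_distrib_right power_add mult_ac)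
  also have "\<dots> = (\<Sum>v\<in>I. \<Sum>i\<le>n. \<Sum>j\<le>n. w v * ((of_int (x i) * l v ^ i) * (of_int (x j) * l v ^ j)))"
    by (subst (2) sum.swap, subst sum.swap) simp
  also have "\<dots> = (\<Sum>v\<in>I. w v * (\<Sum>i\<le>n. of_int (x i) * l v ^ i)^2)"
    unfolding power2_eq_square sum_product unfolding sum_distrib_left ..
  also have "\<dots> \<ge> 0" by (intro sum_nonneg mult_nonneg_nonneg w) auto
  finally show ?thesis by (simp only: of_int_0_le_iff)
qed

text \<open>With \<open>x\<close> the last column of the adjugate, the quadratic form of the Hankel matrix takes
  the value \<open>det H\<^sub>n * det H\<^sub>n\<^sub>-\<^sub>1\<close>, so consecutive nonzero determinants have the same sign.\<close>

lemma det_hankel_pos: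
  fixes a :: "nat \<Rightarrow> int"
  assumes form: "\<And>n x. (\<Sum>i\<le>n. \<Sum>j\<le>n. x i * a (i + j) * x j) \<ge> 0"
    and nz: "\<And>n. det (hankel a n) \<noteq> 0"
  shows "det (hankel a n) > 0"
proof (induction n)
  case 0
  have "det (hankel a 0) = a 0" by (simp add: hankel_def det_single)
  then show ?case using form[where n=0 and x="\<lambda>_. 1"] nz[of 0] by simp
next
  case (Suc n)
  define H where "H = hankel a (Suc n)"
  have H: "H \<in> carrier_mat (Suc (Suc n)) (Suc (Suc n))" by (simp add: H_def hankel_def)
  define x where "x j = adj_mat H $$ (j, Suc n)" for j
  have Hx: "(\<Sum>j\<le>Suc n. a (i + j) * x j) = (if i = Suc n then det H else 0)" if "i \<le> Suc n" for i
  proof -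
    have "(\<Sum>j\<le>Suc n. a (i + j) * x j) = (H * adj_mat H) $$ (i, Suc n)"
      using that H adj_mat(1)[OF H]
      by (simp add: scalar_prod_def x_def H_def hankel_def atLeast0LessThan lessThan_Suc_atMost)
    also have "\<dots> = (if i = Suc n then det H else 0)"
      using that by (simp add: adj_mat(2)[OF H])
    finally show ?thesis .
  qed
  have "(\<Sum>i\<le>Suc n. \<Sum>j\<le>Suc n. x i * a (i + j) * x j)
      = (\<Sum>i\<le>Suc n. x i * (\<Sum>j\<le>Suc n. a (i + j) * x j))"
    by (simp only: sum_distrib_left mult.assoc)
  also have "\<dots> = (\<Sum>i\<le>Suc n. if i = Suc n then x i * det H else 0)"
    by (rule sum.cong) (simp_all add: Hx del: sum.atMost_Suc)
  also have "\<dots> = x (Suc n) * det H" by (subst sum.delta) auto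
  also have "x (Suc n) = det (mat_delete H (Suc n) (Suc n))"
    using H by (simp add: x_def adj_mat_def cofactor_def)
  also have "mat_delete H (Suc n) (Suc n) = hankel a n"
    by (rule eq_matI) (auto simp: mat_delete_def H_def hankel_def insert_index_def)
  finally have "det (hankel a n) * det H \<ge> 0"
    using form[where n="Suc n" and x=x] by simp
  then show ?case using Suc nz[of "Suc n"] unfolding H_def
    by (metis linorder_neqE_linordered_idom mult_pos_neg not_le)
qed

section \<open>Moment representations\<close>

lemma central_binomial_moment:
  assumes "k < N"
  shows "(\<Sum>t<N. norm (1 + cis (2 * pi * real t / real N)) ^ (2 * k)) = real N * real ((2*k) choose k)"
proof -
  have "real ((2*k) choose k) = (\<Sum>j\<le>k. real (k choose j)^2)"
    unfolding choose_square_sum[symmetric] by simp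
  then show ?thesis using sum_norm_power_roots_unity[OF assms, of 1 1] by simp
qed

text \<open>The node is the squared length of a four-step planar walk 1 + z1 + z3 + z2 z3. Averaging
  over z3 gives the factors C(m,k)^2 by Parseval; averaging over z1 and z2 gives the two central
  binomials.\<close>

lemma domb_form_nonneg: "(\<Sum>i\<le>n. \<Sum>j\<le>n. x i * domb (i + j) * x j) \<ge> 0"
proof -
  \<comment> \<open>\<open>N\<close> exceeds every moment order in the form, which makes the
    averages over roots of unity exact.\<close>
  define N where "N = Suc (2 * n)"
  define w where "w t = cis (2 * pi * real t / real N)" for t
  define I where "I = {..<N} \<times> {..<N} \<times> {..<N}"
  define l where "l = (\<lambda>(s,t,u). norm ((1 + w s) + (1 + w t) * w u) ^ 2)"
  show ?thesis
  proof (rule hankel_form_nonneg[where I = I and w = "\<lambda>_. 1 / real N ^ 3" and l = l])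
    fix m assume "m \<le> 2 * n"
    then have m: "m < N" by (simp add: N_def)
    have b: "(\<Sum>t<N. norm (1 + w t) ^ (2 * k)) = real N * real ((2*k) choose k)" if "k \<le> m" for k
      using central_binomial_moment[of k N] that m by (simp add: w_def)
    have "(\<Sum>v\<in>I. l v ^ m) = (\<Sum>(s,t,u)\<in>I. norm ((1 + w s) + (1 + w t) * w u) ^ (2 * m))"
      by (rule sum.cong) (auto simp: l_def power_mult)
    also have "\<dots> = (\<Sum>s<N. \<Sum>t<N. \<Sum>u<N. norm ((1 + w s) + (1 + w t) * w u) ^ (2 * m))"
      unfolding I_def sum.cartesian_product[symmetric] ..
    also have "\<dots> = (\<Sum>s<N. \<Sum>t<N. \<Sum>k\<le>m. real N * real (m choose k)^2
        * norm (1 + w s) ^ (2 * (m - k)) * norm (1 + w t) ^ (2 * k))"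
      unfolding w_def sum_norm_power_roots_unity[OF m] by (simp add: sum_distrib_left mult_ac)
    also have "\<dots> = (\<Sum>k\<le>m. real N * real (m choose k)^2
        * (\<Sum>s<N. norm (1 + w s) ^ (2 * (m - k))) * (\<Sum>t<N. norm (1 + w t) ^ (2 * k)))"
      unfolding mult.assoc sum_product unfolding sum_distrib_left
      by (subst (2) sum.swap, subst sum.swap) (simp add: mult.assoc)
    also have "\<dots> = (\<Sum>k\<le>m. real N ^ 3 * (real (m choose k)^2 * real ((2*k) choose k) * real ((2*(m-k)) choose (m-k))))"
      by (rule sum.cong) (simp_all add: b power3_eq_cube)
    also have "\<dots> = real N ^ 3 * of_int (domb m)"
      by (simp add: domb_def atLeast0AtMost sum_distrib_left)
    finally have "(\<Sum>v\<in>I. l v ^ m) = real N ^ 3 * of_int (domb m)" .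
    moreover have "real N \<noteq> 0" by (simp add: N_def)
    ultimately show "of_int (domb m) = (\<Sum>v\<in>I. 1 / real N ^ 3 * l v ^ m)"
      by (simp flip: sum_divide_distrib)
  qed simp
qed

text \<open>The product of two independent factors |1 + z| yields the squared central binomial as
  even moment; the symmetric sign \<open>e\<close> kills the odd moments.\<close>

lemma aerated_square_form_nonneg: "(\<Sum>i\<le>n. \<Sum>j\<le>n. x i * (aerated (i + j))^2 * x j) \<ge> 0"
proof -
  define N where "N = Suc (2 * n)"
  define w where "w t = norm (1 + cis (2 * pi * real t / real N))" for t
  define I where "I = {1, -1::real} \<times> {..<N} \<times> {..<N}"
  define l where "l = (\<lambda>(e,s,t). e * (w s * w t))"
  show ?thesis
  proof (rule hankel_form_nonneg[where I = I and w = "\<lambda>_. 1 / (2 * real N ^ 2)" and l = l])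
    fix m assume "m \<le> 2 * n"
    then have m: "m < N" by (simp add: N_def)
    have "(\<Sum>v\<in>I. l v ^ m) = (\<Sum>(e,s,t)\<in>I. e ^ m * (w s ^ m * w t ^ m))"
      by (rule sum.cong) (auto simp: l_def power_mult_distrib)
    also have "\<dots> = (\<Sum>e\<in>{1,-1}. \<Sum>s<N. \<Sum>t<N. e ^ m * (w s ^ m * w t ^ m))"
      unfolding I_def sum.cartesian_product[symmetric] ..
    also have "\<dots> = (1 + (-1)^m) * (\<Sum>s<N. w s ^ m)^2"
      unfolding power2_eq_square sum_product by (simp add: sum_distrib_left distrib_right sum.distrib)
    also have "\<dots> = 2 * real N ^ 2 * of_int ((aerated m)^2)"
    proof (cases "even m")
      case True
      then obtain k where k: "m = 2 * k" by (elim evenE)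
      have "(\<Sum>s<N. w s ^ m) = real N * real (m choose k)"
        unfolding k w_def using m k by (intro central_binomial_moment) simp
      then show ?thesis by (simp add: aerated_def k power_mult_distrib)
    qed (simp add: aerated_def)
    finally have "(\<Sum>v\<in>I. l v ^ m) = 2 * real N ^ 2 * of_int ((aerated m)^2)" .
    moreover have "real N \<noteq> 0" by (simp add: N_def)
    ultimately show "of_int ((aerated m)^2) = (\<Sum>v\<in>I. 1 / (2 * real N ^ 2) * l v ^ m)"
      by (simp flip: sum_divide_distrib)
  qed simp
qed

section \<open>The Hankel determinants\<close>

lemma det_hankel_domb: "\<exists>k. k > 0 \<and> odd k \<and> det (hankel domb n) = 12 ^ n * k"
proof -
  \<comment> \<open>Stated for every size, because \<open>det_hankel_pos\<close> compares
    consecutive determinants.\<close>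
  have ex: "\<exists>k. odd k \<and> det (hankel domb n) = (4 * 3) ^ n * k" for n
  proof (rule det_hankel_odd_multiple)
    show "domb 0 = 1" by (simp add: domb_def)
    show "3 dvd domb (i + j) - domb i * domb j" for i j
      using cong_mult[OF domb_cong_3[of i] domb_cong_3[of j]] domb_cong_3[of "i + j"]
      unfolding cong_iff_dvd_diff by presburger
    show "4 dvd domb m" if "m > 0" for m
      using domb_cong_8[OF that] even_central_binomial[OF that]
      unfolding cong_iff_dvd_diff by presburger
  qed (simp_all add: domb_cong_8)
  then have "det (hankel domb n) \<noteq> 0" for n
    using ex[of n] by force
  then have "det (hankel domb n) > 0"
    by (rule det_hankel_pos[OF domb_form_nonneg])
  with ex[of n] show ?thesis by (auto simp: zero_less_mult_iff)
qed

lemma det_hankel_aerated_square: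
  "\<exists>k. k > 0 \<and> odd k \<and> det (hankel (\<lambda>m. (aerated m)^2) n) = 4 ^ n * k"
proof -
  have ex: "\<exists>k. odd k \<and> det (hankel (\<lambda>m. (aerated m)^2) n) = (4 * 1) ^ n * k" for n
  proof (rule det_hankel_odd_multiple)
    show "4 dvd (aerated m)^2" if "m > 0" for m
      using even_aerated[OF that] by (auto elim!: evenE)
  qed (simp_all add: aerated_square_cong, simp add: aerated_def)
  then have "det (hankel (\<lambda>m. (aerated m)^2) n) \<noteq> 0" for n
    using ex[of n] by force
  then have "det (hankel (\<lambda>m. (aerated m)^2) n) > 0"
    by (rule det_hankel_pos[where a = "\<lambda>m. (aerated m)^2", OF aerated_square_form_nonneg])
  with ex[of n] show ?thesis by (auto simp: zero_less_mult_iff)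
qed

text \<open>The binomial theorem for the operator c + S, where the shift S commutes with
  multiplication by c.\<close>

lemma funpow_shift_plus_const:
  fixes f :: "nat \<Rightarrow> 'a :: comm_semiring_1"
  shows "((\<lambda>f m. c * f m + f (Suc m)) ^^ i) f m
    = (\<Sum>k\<le>i. of_nat (i choose k) * c ^ (i - k) * f (m + k))"
proof (induction i arbitrary: m)
  case (Suc i)
  let ?S = "\<Sum>k\<le>i. of_nat (i choose Suc k) * c ^ (i - k) * f (m + Suc k)"
  have "c * (\<Sum>k\<le>i. of_nat (i choose k) * c ^ (i - k) * f (m + k))
    = (\<Sum>k\<le>i. of_nat (i choose k) * c ^ (Suc i - k) * f (m + k))"
    unfolding sum_distrib_left by (rule sum.cong) (simp_all add: Suc_diff_le mult_ac)
  also have "\<dots> = (\<Sum>k\<le>Suc i. of_nat (i choose k) * c ^ (Suc i - k) * f (m + k))"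
    by (simp add: binomial_eq_0)
  also have "\<dots> = c ^ Suc i * f m + ?S"
    by (subst sum.atMost_Suc_shift) simp
  finally have 1: "c * (\<Sum>k\<le>i. of_nat (i choose k) * c ^ (i - k) * f (m + k)) = c ^ Suc i * f m + ?S" .
  have "(\<Sum>k\<le>Suc i. of_nat (Suc i choose k) * c ^ (Suc i - k) * f (m + k))
    = c ^ Suc i * f m + (?S + (\<Sum>k\<le>i. of_nat (i choose k) * c ^ (i - k) * f (Suc m + k)))"
    by (subst sum.atMost_Suc_shift) (simp add: sum.distrib distrib_left distrib_right ac_simps)
  then show ?case by (simp only: funpow.simps comp_def Suc 1) (simp only: add.assoc)
qed simp

text \<open>The Hankel matrix of the binomial transform of \<open>u\<close> is \<open>M * hankel u n * M\<^sup>T\<close> with \<open>M\<close>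
  lower triangular: both sides expand \<open>(c + S)\<^sup>i (c + S)\<^sup>j u\<close> at \<open>0\<close>, where \<open>S\<close> is the shift.\<close>

lemma det_hankel_binomial_transform:
  fixes u :: "nat \<Rightarrow> 'a :: comm_ring_1"
  shows "det (hankel (\<lambda>m. d ^ m * (\<Sum>k\<le>m. of_nat (m choose k) * c ^ (m - k) * u k)) n)
    = d ^ (n * (n + 1)) * det (hankel u n)"
proof -
  define w where "w m = (\<Sum>k\<le>m. of_nat (m choose k) * c ^ (m - k) * u k)" for m
  define M where "M = mat (Suc n) (Suc n) (\<lambda>(i,k). d ^ i * (of_nat (i choose k) * c ^ (i - k)))"
  have M: "M \<in> carrier_mat (Suc n) (Suc n)" by (simp add: M_def)
  have U: "hankel u n \<in> carrier_mat (Suc n) (Suc n)" by (simp add: hankel_def)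
  let ?\<Phi> = "\<lambda>f m. c * f m + f (Suc m)"
  have w_add: "w (i + j) = (\<Sum>k\<le>i. \<Sum>l\<le>j. of_nat (i choose k) * c ^ (i - k)
      * (of_nat (j choose l) * c ^ (j - l) * u (k + l)))" for i j
  proof -
    have "w (i + j) = (?\<Phi> ^^ i) ((?\<Phi> ^^ j) u) 0"
      unfolding w_def using funpow_shift_plus_const[of "i + j" c u 0] by (simp add: funpow_add)
    also have "\<dots> = (\<Sum>k\<le>i. of_nat (i choose k) * c ^ (i - k)
        * (\<Sum>l\<le>j. of_nat (j choose l) * c ^ (j - l) * u (k + l)))"
      unfolding funpow_shift_plus_const by simp
    finally show ?thesis by (simp only: sum_distrib_left)
  qed
  have "hankel (\<lambda>m. d ^ m * w m) n = M * (hankel u n * transpose_mat M)"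
  proof (rule eq_matI)
    fix i j assume "i < dim_row (M * (hankel u n * transpose_mat M))"
      "j < dim_col (M * (hankel u n * transpose_mat M))"
    then have ij: "i < Suc n" "j < Suc n" by (simp_all add: M_def)
    have ext: "(\<Sum>k\<le>i. of_nat (i choose k) * g k) = (\<Sum>k<Suc n. of_nat (i choose k) * g k)"
      if "i < Suc n" for i and g :: "nat \<Rightarrow> 'a"
      by (rule sum.mono_neutral_left) (use that in \<open>auto simp: binomial_eq_0\<close>)
    have "w (i + j) = (\<Sum>k\<le>i. of_nat (i choose k) * (c ^ (i - k)
      * (\<Sum>l\<le>j. of_nat (j choose l) * (c ^ (j - l) * u (k + l)))))"
      unfolding w_add by (simp add: sum_distrib_left mult.assoc)
    also have "\<dots> = (\<Sum>k<Suc n. of_nat (i choose k) * (c ^ (i - k)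
      * (\<Sum>l<Suc n. of_nat (j choose l) * (c ^ (j - l) * u (k + l)))))"
      unfolding ext[OF ij(1)] ext[OF ij(2)] ..
    finally have "d ^ (i + j) * w (i + j)
      = (\<Sum>k<Suc n. d ^ i * (of_nat (i choose k) * c ^ (i - k))
        * (\<Sum>l<Suc n. u (k + l) * (d ^ j * (of_nat (j choose l) * c ^ (j - l)))))"
      by (simp add: sum_distrib_left power_add mult_ac del: sum.lessThan_Suc)
    also have "\<dots> = (M * (hankel u n * transpose_mat M)) $$ (i,j)"
      using ij by (simp add: scalar_prod_def M_def hankel_def lessThan_atLeast0
          del: sum.atLeast0_lessThan_Suc)
    finally show "hankel (\<lambda>m. d ^ m * w m) n $$ (i,j) = (M * (hankel u n * transpose_mat M)) $$ (i,j)"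
      using ij by (simp add: hankel_def)
  qed (simp_all add: M_def hankel_def)
  then have "det (hankel (\<lambda>m. d ^ m * w m) n) = det M * (det (hankel u n) * det M)"
    using M U by (simp add: det_mult[of _ "Suc n"] det_transpose[OF M])
  also have "det M = prod_list (diag_mat M)"
    by (rule det_lower_triangular[OF _ M]) (auto simp: M_def binomial_eq_0)
  also have "\<dots> = (\<Prod>i<Suc n. d ^ i)"
    unfolding prod_list_diag_prod by (rule prod.cong) (auto simp: M_def)
  also have "(\<Prod>i<Suc n. d ^ i) * (det (hankel u n) * (\<Prod>i<Suc n. d ^ i))
    = (\<Prod>i<Suc n. d ^ i)^2 * det (hankel u n)" by (simp only: power2_eq_square mult_ac)
  \<comment> \<open>Taking the square first keeps the exponent free of a division by 2.\<close>
  also have "(\<Prod>i<Suc n. d ^ i)^2 = d ^ (n * (n + 1))"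
  proof (induction n)
    case (Suc n)
    have "(\<Prod>i<Suc (Suc n). d ^ i)^2 = (\<Prod>i<Suc n. d ^ i)^2 * (d ^ Suc n)^2"
      by (simp only: prod.lessThan_Suc power_mult_distrib)
    also have "\<dots> = d ^ (n * (n + 1) + Suc n * 2)"
      by (simp only: Suc power_add power_mult)
    also have "n * (n + 1) + Suc n * 2 = Suc n * (Suc n + 1)" by simp
    finally show ?case .
  qed simp
  finally show ?thesis by (simp only: w_def)
qed

text \<open>As 8^m = 2^m 4^(m-k) 4^k, the denominators in \<open>clf_aux\<close> cancel; the
  determinant can then be computed over the integers.\<close>

lemma clf_eq_binomial_transform:
  "clf m = of_int (2 ^ m * (\<Sum>k\<le>m. of_nat (m choose k) * 4 ^ (m - k) * (aerated k)^2))"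
proof -
  have *: "8 ^ m * (of_nat (m choose k) * (of_int (aerated k) / 2 ^ k)^2)
     = (2 ^ m * (of_nat (m choose k) * 4 ^ (m - k) * of_int (aerated k)^2) :: rat)" if "k \<le> m" for k
  proof -
    have "(8::rat) ^ m = 2 ^ m * (4 ^ (m - k) * 4 ^ k)"
      using that by (simp flip: power_add power_mult_distrib)
    moreover have "(4::rat) ^ k = (2 ^ k)^2"
      by (simp add: power2_eq_square flip: power_mult_distrib)
    ultimately show ?thesis by (simp add: power_divide)
  qed
  show ?thesis
    unfolding clf_eq clf_aux_def of_int_mult of_int_power of_int_numeral of_int_sum of_int_of_nat_eq
      sum_distrib_left
    by (intro sum.cong refl *) simp
qed

lemma det_hankel_clf: "\<exists>k::int. k > 0 \<and> odd k \<and> det (hankel clf n) = 2 ^ (n * (n + 3)) * of_int k"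
proof -
  obtain k where k: "k > 0" "odd k" "det (hankel (\<lambda>m. (aerated m)^2) n) = 4 ^ n * k"
    using det_hankel_aerated_square by blast
  define v where "v m = 2 ^ m * (\<Sum>k\<le>m. of_nat (m choose k) * 4 ^ (m - k) * (aerated k)^2)" for m
  have "hankel clf n = map_mat of_int (hankel v n)"
    by (rule eq_matI) (simp_all add: hankel_def clf_eq_binomial_transform v_def)
  then have "det (hankel clf n) = of_int (det (hankel v n))" by (simp add: of_int_hom.hom_det)
  \<comment> \<open>The transform has d = 2 and c = 4. Its exponent n(n+1) and the 2n from
    \<open>4 ^ n\<close> add up to n(n+3).\<close>
  also have "det (hankel v n) = 2 ^ (n * (n + 1)) * (4 ^ n * k)"
    unfolding v_def det_hankel_binomial_transform k(3) ..
  also have "\<dots> = 2 ^ (n * (n + 1)) * (2 ^ (2 * n) * k)" by (simp add: power_mult)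
  also have "\<dots> = 2 ^ (n * (n + 3)) * k"
    by (simp add: algebra_simps flip: power_add mult.assoc)
  finally show ?thesis using k by auto
qed

theorem theorem1p2:
  fixes n :: nat
  shows "(\<exists>k::int. k > 0 \<and> odd k \<and>
            of_int (det (hankel domb n)) / (12::rat) ^ n = of_int k)
       \<and> (\<exists>k::int. k > 0 \<and> odd k \<and>
            det (hankel clf n) / (2::rat) ^ (n * (n + 3)) = of_int k)"
  using det_hankel_domb[of n] det_hankel_clf[of n] by auto

end
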